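(* Let $\mathcal{A}$ be a $\mathbf{tDL}$-algebra with associated tense Priestley space $(X(A),R_A)$. Then the lattice $C_t(X(A))$ of all closed $\mathbf{tPS}$-sets of $(X(A),R_A)$ (ordered by inclusion) is isomorphic to the dual of the lattice $\mathrm{Con}_t(\mathcal{A})$ of all congruences of $\mathcal{A}$; the anti-isomorphism is $\varphi:C_t(X(A))\to\mathrm{Con}_t(\mathcal{A})$, $\varphi(Y)=\Theta(Y)=\{(a,b)\in A\times A:\sigma_A(a)\cap Y=\sigma_A(b)\cap Y\}$.
   Context: A $\mathbf{tDL}$-algebra is a bounded distributive lattice $\langle A,\wedge,\vee,0,1\rangle$ with unary operators $\mathbf{G},\mathbf{H},\mathbf{F},\mathbf{P}$ such that for all $x,y$: $\mathbf{G}1=\mathbf{H}1=1$; $\mathbf{G},\mathbf{H}$ preserve $\wedge$; $x\le\mathbf{G}\mathbf{P}x$, $x\le\mathbf{H}\mathbf{F}x$; $\mathbf{G}(x\vee y)\le\mathbf{G}x\vee\mathbf{F}y$, $\mathbf{H}(x\vee y)\le\mathbf{H}x\vee\mathbf{P}y$; $\mathbf{F}0=\mathbf{P}0=0$; $\mathbf{F},\mathbf{P}$ preserve $\vee$; $\mathbf{P}\mathbf{G}x\le x$, $\mathbf{F}\mathbf{H}x\le x$; $\mathbf{G}x\wedge\mathbf{F}y\le\mathbf{F}(x\wedge y)$, $\mathbf{H}x\wedge\mathbf{P}y\le\mathbf{P}(x\wedge y)$. Its congruences are lattice congruences compatible with the four operators. $X(A)$ is the set of prime filters of the lattice ordered by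 inclusion, with the Priestley topology generated by the sets $\sigma_A(a)=\{T\in X(A):a\in T\}$ and their complements; $(S,T)\in R_A$ iff $\{a:\mathbf{G}a\in S\}\subseteq T\subseteq\{a:\mathbf{F}a\in S\}$. For a relation $R$, $R(x)=\{y:(x,y)\in R\}$, $R^{-1}(x)=\{y:(y,x)\in R\}$. A subset $Y$ of $X(A)$ is a $\mathbf{tPS}$-set if for all $x,y$: (tc1) if $x\in R_A^{-1}(y)\cap Y$ then there are $w_1,w_2\in R_A(x)\cap Y$ with $w_1\subseteq y\subseteq w_2$; (tc2) if $x\in R_A(y)\cap Y$ then there are $w_1,w_2\in R_A^{-1}(x)\cap Y$ with $w_1\subseteq y\subseteq w_2$. $C_t(X(A))$ is the set of $\mathbf{tPS}$-sets that are closed in the topology. *)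

theory Defs
  imports "HOL-Analysis.Analysis" "HOL-Algebra.Lattice"
begin

text \<open>
  The algebra lives on a type of classes \<open>distrib_lattice\<close> and \<open>bounded_lattice\<close> (the degenerate
  case \<open>bot = top\<close> is allowed). \<open>HOL-Algebra\<close> is used for the lattices of closed tPS-sets and of
  congruences, which are families of sets. The operations of the algebra are written in bold, as
  \<open>HOL-Algebra\<close> reuses the names \<open>inf\<close>, \<open>sup\<close> and \<open>top\<close>.
\<close>

abbreviation (input) meetA :: "'a::semilattice_inf \<Rightarrow> 'a \<Rightarrow> 'a" (infixl \<open>\<^bold>\<and>\<close> 70)
  where "x \<^bold>\<and> y \<equiv> inf_class.inf x y"

abbreviation (input) joinA :: "'a::semilattice_sup \<Rightarrow> 'a \<Rightarrow> 'a" (infixl \<open>\<^bold>\<or>\<close> 65)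
  where "x \<^bold>\<or> y \<equiv> sup_class.sup x y"

abbreviation (input) zeroA :: "'a::bounded_lattice" (\<open>\<^bold>0\<close>)
  where "\<^bold>0 \<equiv> bot_class.bot"

abbreviation (input) oneA :: "'a::bounded_lattice" (\<open>\<^bold>1\<close>)
  where "\<^bold>1 \<equiv> top_class.top"

locale tDL_algebra =
  fixes G H F P :: "'a::{distrib_lattice, bounded_lattice} \<Rightarrow> 'a"
  assumes G_one: "G \<^bold>1 = \<^bold>1"
    and H_one: "H \<^bold>1 = \<^bold>1"
    and G_meet: "G (x \<^bold>\<and> y) = G x \<^bold>\<and> G y"
    and H_meet: "H (x \<^bold>\<and> y) = H x \<^bold>\<and> H y"
    and le_GP: "x \<le> G (P x)"
    and le_HF: "x \<le> H (F x)"
    and G_join: "G (x \<^bold>\<or> y) \<le> G x \<^bold>\<or> F y"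
    and H_join: "H (x \<^bold>\<or> y) \<le> H x \<^bold>\<or> P y"
    and F_zero: "F \<^bold>0 = \<^bold>0"
    and P_zero: "P \<^bold>0 = \<^bold>0"
    and F_join: "F (x \<^bold>\<or> y) = F x \<^bold>\<or> F y"
    and P_join: "P (x \<^bold>\<or> y) = P x \<^bold>\<or> P y"
    and PG_le: "P (G x) \<le> x"
    and FH_le: "F (H x) \<le> x"
    and F_meet: "G x \<^bold>\<and> F y \<le> F (x \<^bold>\<and> y)"
    and P_meet: "H x \<^bold>\<and> P y \<le> P (x \<^bold>\<and> y)"

definition tDL_congruence ::
  "('a::{distrib_lattice, bounded_lattice} \<Rightarrow> 'a) \<Rightarrow> ('a \<Rightarrow> 'a) \<Rightarrow> ('a \<Rightarrow> 'a) \<Rightarrow> ('a \<Rightarrow> 'a) \<Rightarrow> 'a rel \<Rightarrow> bool"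
  where "tDL_congruence G H F P \<theta> \<longleftrightarrow>
    equiv UNIV \<theta> \<and>
    (\<forall>a b c d. (a, b) \<in> \<theta> \<and> (c, d) \<in> \<theta> \<longrightarrow> (a \<^bold>\<and> c, b \<^bold>\<and> d) \<in> \<theta> \<and> (a \<^bold>\<or> c, b \<^bold>\<or> d) \<in> \<theta>) \<and>
    (\<forall>a b. (a, b) \<in> \<theta> \<longrightarrow>
      (G a, G b) \<in> \<theta> \<and> (H a, H b) \<in> \<theta> \<and> (F a, F b) \<in> \<theta> \<and> (P a, P b) \<in> \<theta>)"

text \<open>Prime filters are proper (\<open>\<^bold>0 \<notin> T\<close>) and nonempty (\<open>\<^bold>1 \<in> T\<close>).\<close>

definition prime_filter :: "'a::{distrib_lattice, bounded_lattice} set \<Rightarrow> bool"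
  where "prime_filter T \<longleftrightarrow>
    \<^bold>1 \<in> T \<and> \<^bold>0 \<notin> T \<and>
    (\<forall>a b. a \<in> T \<and> a \<le> b \<longrightarrow> b \<in> T) \<and>
    (\<forall>a b. a \<in> T \<and> b \<in> T \<longrightarrow> a \<^bold>\<and> b \<in> T) \<and>
    (\<forall>a b. a \<^bold>\<or> b \<in> T \<longrightarrow> a \<in> T \<or> b \<in> T)"

definition prime_filters :: "'a::{distrib_lattice, bounded_lattice} set set"
  where "prime_filters = {T. prime_filter T}"

definition sigma_A :: "'a::{distrib_lattice, bounded_lattice} \<Rightarrow> 'a set set"
  where "sigma_A a = {T \<in> prime_filters. a \<in> T}"

text \<open>The underlying set of this topology is \<open>prime_filters\<close>, since \<open>sigma_A \<^bold>1 = prime_filters\<close>.\<close>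

definition priestley_topology :: "'a::{distrib_lattice, bounded_lattice} set topology"
  where "priestley_topology =
    topology_generated_by (range sigma_A \<union> range (\<lambda>a. prime_filters - sigma_A a))"

definition R_A ::
  "('a::{distrib_lattice, bounded_lattice} \<Rightarrow> 'a) \<Rightarrow> ('a \<Rightarrow> 'a) \<Rightarrow> 'a set rel"
  where "R_A G F =
    {(S, T). S \<in> prime_filters \<and> T \<in> prime_filters \<and> {a. G a \<in> S} \<subseteq> T \<and> T \<subseteq> {a. F a \<in> S}}"

text \<open>\<open>R_A G F `` {x}\<close> is \<open>R(x)\<close> and \<open>(R_A G F)\<inverse> `` {x}\<close> is \<open>R\<^sup>-\<^sup>1(x)\<close>.\<close>

definition tPS_set ::
  "('a::{distrib_lattice, bounded_lattice} \<Rightarrow> 'a) \<Rightarrow> ('a \<Rightarrow> 'a) \<Rightarrow> 'a set set \<Rightarrow> bool"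
  where "tPS_set G F Y \<longleftrightarrow>
    Y \<subseteq> prime_filters \<and>
    (\<forall>x\<in>prime_filters. \<forall>y\<in>prime_filters.
      (x \<in> (R_A G F)\<inverse> `` {y} \<inter> Y \<longrightarrow>
        (\<exists>w\<^sub>1 \<in> R_A G F `` {x} \<inter> Y. \<exists>w\<^sub>2 \<in> R_A G F `` {x} \<inter> Y. w\<^sub>1 \<subseteq> y \<and> y \<subseteq> w\<^sub>2)) \<and>
      (x \<in> R_A G F `` {y} \<inter> Y \<longrightarrow>
        (\<exists>w\<^sub>1 \<in> (R_A G F)\<inverse> `` {x} \<inter> Y. \<exists>w\<^sub>2 \<in> (R_A G F)\<inverse> `` {x} \<inter> Y. w\<^sub>1 \<subseteq> y \<and> y \<subseteq> w\<^sub>2)))"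

abbreviation inclusion_order :: "'b set set \<Rightarrow> 'b set gorder"
  where "inclusion_order \<C> \<equiv> \<lparr>carrier = \<C>, eq = (=), le = (\<subseteq>)\<rparr>"

definition closed_tPS_lattice ::
  "('a::{distrib_lattice, bounded_lattice} \<Rightarrow> 'a) \<Rightarrow> ('a \<Rightarrow> 'a) \<Rightarrow> 'a set set gorder"
  where "closed_tPS_lattice G F =
    inclusion_order {Y. tPS_set G F Y \<and> closedin priestley_topology Y}"

definition congruence_lattice ::
  "('a::{distrib_lattice, bounded_lattice} \<Rightarrow> 'a) \<Rightarrow> ('a \<Rightarrow> 'a) \<Rightarrow> ('a \<Rightarrow> 'a) \<Rightarrow> ('a \<Rightarrow> 'a) \<Rightarrow> ('a \<times> 'a) set gorder"
  where "congruence_lattice G H F P = inclusion_order {\<theta>. tDL_congruence G H F P \<theta>}"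

definition Theta :: "'a::{distrib_lattice, bounded_lattice} set set \<Rightarrow> 'a rel"
  where "Theta Y = {(a, b). sigma_A a \<inter> Y = sigma_A b \<inter> Y}"

definition lattice_isomorphism ::
  "('b, 'm) gorder_scheme \<Rightarrow> ('c, 'n) gorder_scheme \<Rightarrow> ('b \<Rightarrow> 'c) \<Rightarrow> bool"
  where "lattice_isomorphism L M h \<longleftrightarrow>
    bij_betw h (carrier L) (carrier M) \<and>
    (\<forall>x\<in>carrier L. \<forall>y\<in>carrier L.
      h (x \<squnion>\<^bsub>L\<^esub> y) = h x \<squnion>\<^bsub>M\<^esub> h y \<and> h (x \<sqinter>\<^bsub>L\<^esub> y) = h x \<sqinter>\<^bsub>M\<^esub> h y)"

end

theory Submission
  imports Defs "HOL-Algebra.Complete_Lattice"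
begin

text \<open>
  The inverse of \<open>Theta\<close> sends a congruence \<open>\<theta>\<close> to the set of all \<open>\<theta>\<close>-saturated prime filters.
  That the two maps are mutually inverse rests on the prime filter theorem modulo \<open>\<theta>\<close> and on the sets
  \<open>\<sigma>(a) - \<sigma>(b)\<close> being a base of the topology. For closed \<open>Y\<close>, conditions (tc1) and (tc2) let prime
  filters that witness \<open>G b \<notin> x\<close> or \<open>F a \<in> x\<close> be moved into \<open>Y\<close>, so \<open>Theta Y\<close> respects the
  operators; conversely, for \<open>\<theta>\<close>-saturated \<open>x\<close> and \<open>(x, y) \<in> R\<close>, the filter \<open>{a. G a \<in> x}\<close> can be
  separated modulo \<open>\<theta>\<close> from the ideal \<open>- y\<close>, and the filter \<open>y\<close> from the ideal \<open>{a. F a \<notin> x}\<close>, which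
  yields (tc1). The past operators are handled by the symmetry exchanging \<open>(G, F)\<close> and \<open>(H, P)\<close>,
  because \<open>R_A H P\<close> is the converse of \<open>R_A G F\<close>.
\<close>

subsection \<open>Prime filters modulo a lattice congruence\<close>

text \<open>One direction suffices: for symmetric \<open>\<theta>\<close> this says that
  \<open>T\<close> is a union of classes. The one-sided form shows directly which basic open sets a
  saturated filter avoids.\<close>

definition saturated :: "'a rel \<Rightarrow> 'a set \<Rightarrow> bool"
  where "saturated \<theta> T \<longleftrightarrow> (\<forall>(a, b)\<in>\<theta>. a \<in> T \<longrightarrow> b \<in> T)"

text \<open>The part of a congruence that concerns the lattice only, kept apart so that the prime
  filter theorem serves both the congruences of the algebra and equality.\<close>

locale lattice_congruence =
  fixes \<theta> :: "'a::{distrib_lattice, bounded_lattice} rel"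
  assumes cong_equiv: "equiv UNIV \<theta>"
    and cong_meet: "(a, b) \<in> \<theta> \<Longrightarrow> (c, d) \<in> \<theta> \<Longrightarrow> (a \<^bold>\<and> c, b \<^bold>\<and> d) \<in> \<theta>"
    and cong_join: "(a, b) \<in> \<theta> \<Longrightarrow> (c, d) \<in> \<theta> \<Longrightarrow> (a \<^bold>\<or> c, b \<^bold>\<or> d) \<in> \<theta>"
begin

lemma cong_refl: "(a, a) \<in> \<theta>"
  using cong_equiv by (auto simp: equiv_def refl_on_def)

lemma cong_sym: "(a, b) \<in> \<theta> \<Longrightarrow> (b, a) \<in> \<theta>"
  using cong_equiv by (auto simp: equiv_def sym_def)

lemma cong_trans: "(a, b) \<in> \<theta> \<Longrightarrow> (b, c) \<in> \<theta> \<Longrightarrow> (a, c) \<in> \<theta>"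
  using cong_equiv unfolding equiv_def trans_def by blast

text \<open>The order of the quotient lattice, pulled back to representatives.\<close>

definition qle :: "'a \<Rightarrow> 'a \<Rightarrow> bool" (infix \<open>\<preceq>\<close> 50)
  where "x \<preceq> y \<longleftrightarrow> (x \<^bold>\<and> y, x) \<in> \<theta>"

lemma le_imp_qle: "x \<le> y \<Longrightarrow> x \<preceq> y"
  by (simp add: qle_def inf_absorb1 cong_refl)

lemma qle_trans:
  assumes "x \<preceq> y" "y \<preceq> z" shows "x \<preceq> z"
proof -
  have 1: "(x \<^bold>\<and> y \<^bold>\<and> z, x \<^bold>\<and> z) \<in> \<theta>"
    using assms(1) cong_meet cong_refl unfolding qle_def by blast
  have 2: "(x \<^bold>\<and> (y \<^bold>\<and> z), x \<^bold>\<and> y) \<in> \<theta>"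
    using assms(2) cong_meet cong_refl unfolding qle_def by blast
  show ?thesis
    using 1 2 assms(1) cong_sym cong_trans unfolding qle_def by (metis inf_assoc)
qed

lemma qle_meet:
  assumes "x \<preceq> y" "x \<preceq> z" shows "x \<preceq> y \<^bold>\<and> z"
  using cong_meet[OF assms[unfolded qle_def]] unfolding qle_def
  by (metis inf_assoc inf_commute inf_idem)

lemma qle_join:
  assumes "x \<preceq> z" "y \<preceq> z" shows "x \<^bold>\<or> y \<preceq> z"
  using cong_join[OF assms[unfolded qle_def]] unfolding qle_def
  by (simp add: inf_sup_distrib2)

lemma cong_imp_qle: "(a, b) \<in> \<theta> \<Longrightarrow> a \<preceq> b"
  using cong_meet[of a b a a] cong_meet[OF cong_refl[of a], of a b] cong_refl cong_sym
  unfolding qle_def by (metis inf_idem)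

lemma qle_antisym: "a \<preceq> b \<Longrightarrow> b \<preceq> a \<Longrightarrow> (a, b) \<in> \<theta>"
  using cong_sym cong_trans unfolding qle_def by (metis inf_commute)

text \<open>The prime filter theorem of the quotient lattice, phrased with representatives.
  \<open>D\<close> need only be closed under meets and \<open>I\<close> under joins, because the
  filter is generated inside the proof. Zorn's lemma gives a filter maximal among those avoiding
  \<open>I\<close>, and distributivity makes it prime.\<close>

theorem prime_filter_separation:
  assumes D: "D \<noteq> {}" "\<And>a b. a \<in> D \<Longrightarrow> b \<in> D \<Longrightarrow> a \<^bold>\<and> b \<in> D"
    and I: "I \<noteq> {}" "\<And>a b. a \<in> I \<Longrightarrow> b \<in> I \<Longrightarrow> a \<^bold>\<or> b \<in> I"
    and sep: "\<And>d i. d \<in> D \<Longrightarrow> i \<in> I \<Longrightarrow> \<not> d \<preceq> i"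
  obtains T where "prime_filter T" "saturated \<theta> T" "D \<subseteq> T" "T \<inter> I = {}"
proof -
  \<comment> \<open>Being upward closed for the quotient order, and not just for
    \<open>\<le>\<close>, is what later makes the maximal \<open>M\<close> saturated.\<close>
  define filt where "filt M \<longleftrightarrow>
    D \<subseteq> M \<and> (\<forall>a\<in>M. \<forall>b\<in>M. a \<^bold>\<and> b \<in> M) \<and> (\<forall>a b. a \<in> M \<longrightarrow> a \<preceq> b \<longrightarrow> b \<in> M)" for M
  \<comment> \<open>Used twice: with \<open>D\<close> itself to start Zorn's lemma, and with the
    meets of \<open>M\<close> with a further element to exploit maximality.\<close>
  have gen: "filt {e. \<exists>d\<in>D'. d \<preceq> e}"
    if "D \<subseteq> {e. \<exists>d\<in>D'. d \<preceq> e}" "\<And>a b. a \<in> D' \<Longrightarrow> b \<in> D' \<Longrightarrow> a \<^bold>\<and> b \<in> D'" for D'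
  proof -
    have "\<exists>d\<in>D'. d \<preceq> a \<^bold>\<and> b" if "d \<in> D'" "d \<preceq> a" "d' \<in> D'" "d' \<preceq> b" for a b d d'
    proof
      show "d \<^bold>\<and> d' \<preceq> a \<^bold>\<and> b"
        using that by (intro qle_meet; meson qle_trans le_imp_qle inf_le1 inf_le2)
    qed (use that \<open>\<And>a b. a \<in> D' \<Longrightarrow> b \<in> D' \<Longrightarrow> a \<^bold>\<and> b \<in> D'\<close> in blast)
    then show ?thesis
      using that(1) qle_trans unfolding filt_def by blast
  qed
  let ?A = "{M. filt M \<and> M \<inter> I = {}}"
  have "\<exists>M\<in>?A. \<forall>X\<in>?A. M \<subseteq> X \<longrightarrow> X = M"
  proof (rule subset_Zorn_nonempty)
    have "filt {e. \<exists>d\<in>D. d \<preceq> e}"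
      by (rule gen) (use D le_imp_qle in blast)+
    moreover have "{e. \<exists>d\<in>D. d \<preceq> e} \<inter> I = {}"
      using sep by blast
    ultimately show "?A \<noteq> {}"
      by blast
  next
    fix C assume C: "C \<noteq> {}" "subset.chain ?A C"
    have CA: "filt M" "M \<inter> I = {}" if "M \<in> C" for M
      using C(2) that unfolding subset_chain_def by blast+
    have "a \<^bold>\<and> b \<in> \<Union>C" if ab: "a \<in> \<Union>C" "b \<in> \<Union>C" for a b
    proof -
      obtain M N where "M \<in> C" "N \<in> C" "a \<in> M" "b \<in> N"
        using ab by blast
      then consider "a \<in> N" "b \<in> N" "filt N" "N \<in> C" | "a \<in> M" "b \<in> M" "filt M" "M \<in> C"
        using C(2) CA(1) unfolding subset_chain_def by blast
      then show ?thesis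
        by cases (auto simp: filt_def)
    qed
    moreover have "D \<subseteq> \<Union>C"
      using C(1) CA(1) unfolding filt_def by blast
    moreover have "b \<in> \<Union>C" if "a \<in> \<Union>C" "a \<preceq> b" for a b
      using CA(1) that unfolding filt_def by blast
    moreover have "\<Union>C \<inter> I = {}"
      using CA(2) by blast
    ultimately show "\<Union>C \<in> ?A"
      unfolding filt_def by blast
  qed
  then obtain M where M: "filt M" "M \<inter> I = {}"
    and max: "\<And>X. filt X \<Longrightarrow> X \<inter> I = {} \<Longrightarrow> M \<subseteq> X \<Longrightarrow> X = M"
      by (auto simp: filt_def)
  have up: "b \<in> M" if "a \<in> M" "a \<preceq> b" for a b
    using M that unfolding filt_def by blast
  have meet: "a \<^bold>\<and> b \<in> M" if "a \<in> M" "b \<in> M" for a b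
    using M that unfolding filt_def by blast
  \<comment> \<open>By maximality, the filter generated by \<open>M\<close> and an element outside
    \<open>M\<close> must meet \<open>I\<close>.\<close>
  have extend: "\<exists>m\<in>M. \<exists>i\<in>I. m \<^bold>\<and> a \<preceq> i" if "a \<notin> M" for a
  proof (rule ccontr)
    assume no: "\<not> ?thesis"
    let ?D = "(\<lambda>m. m \<^bold>\<and> a) ` M"
    let ?X = "{e. \<exists>d\<in>?D. d \<preceq> e}"
    have MX: "M \<subseteq> ?X"
      using le_imp_qle inf_le1 by blast
    moreover have "filt ?X"
    proof (rule gen)
      show "D \<subseteq> ?X"
        using MX M unfolding filt_def by blast
      show "b \<^bold>\<and> c \<in> ?D" if bc: "b \<in> ?D" "c \<in> ?D" for b c
      proof -
        obtain m n where "m \<in> M" "n \<in> M" "b = m \<^bold>\<and> a" "c = n \<^bold>\<and> a"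
          using bc by blast
        then have "b \<^bold>\<and> c = (m \<^bold>\<and> n) \<^bold>\<and> a" "m \<^bold>\<and> n \<in> M"
          using meet by (auto simp: inf_assoc inf_left_commute)
        then show ?thesis
          by blast
      qed
    qed
    ultimately have "?X = M"
      using max[of ?X] no by blast
    moreover obtain m where "m \<in> M"
      using D(1) M(1) unfolding filt_def by blast
    then have "a \<in> ?X"
      using le_imp_qle inf_le2 by blast
    ultimately show False
      using that by blast
  qed
  have "a \<in> M \<or> b \<in> M" if ab: "a \<^bold>\<or> b \<in> M" for a b
  proof (rule ccontr)
    assume "\<not> ?thesis"
    then obtain m i n j where mn: "m \<in> M" "i \<in> I" "m \<^bold>\<and> a \<preceq> i" "n \<in> M" "j \<in> I" "n \<^bold>\<and> b \<preceq> j"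
      using extend by meson
    \<comment> \<open>A common lower bound of \<open>m\<close> and \<open>n\<close> works for
      \<open>a\<close> and \<open>b\<close> at once, so distributivity forces \<open>M\<close> to
      meet \<open>I\<close>.\<close>
    let ?k = "m \<^bold>\<and> n"
    have "?k \<^bold>\<and> a \<preceq> m \<^bold>\<and> a" "i \<preceq> i \<^bold>\<or> j" "?k \<^bold>\<and> b \<preceq> n \<^bold>\<and> b" "j \<preceq> i \<^bold>\<or> j"
      by (simp_all add: le_imp_qle le_infI1)
    then have "(?k \<^bold>\<and> a) \<^bold>\<or> (?k \<^bold>\<and> b) \<preceq> i \<^bold>\<or> j"
      using mn qle_trans qle_join by meson
    then have "?k \<^bold>\<and> (a \<^bold>\<or> b) \<preceq> i \<^bold>\<or> j"
      by (simp add: inf_sup_distrib1)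
    then have "i \<^bold>\<or> j \<in> M"
      using up meet mn ab by blast
    then show False
      using mn I(2) M(2) by blast
  qed
  moreover have "\<^bold>1 \<in> M"
    using D(1) M(1) le_imp_qle top_greatest unfolding filt_def by blast
  moreover have "\<^bold>0 \<notin> M"
    using I(1) M(2) up le_imp_qle bot_least by blast
  ultimately have "prime_filter M"
    unfolding prime_filter_def using meet up le_imp_qle by blast
  moreover have "saturated \<theta> M"
    unfolding saturated_def using up cong_imp_qle by blast
  ultimately show ?thesis
    using that M unfolding filt_def by blast
qed

end

text \<open>For the equality relation the quotient order is \<open>\<le>\<close>, so separation
  becomes the classical prime filter theorem.\<close>

interpretation Id_cong: lattice_congruence Id
  rewrites "lattice_congruence.qle Id = (\<le>)"
proof -
  show "lattice_congruence (Id :: 'a rel)"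
    by unfold_locales (auto simp: equiv_def refl_on_def sym_def trans_def)
  then show "lattice_congruence.qle (Id :: 'a rel) = (\<le>)"
    by (auto simp: lattice_congruence.qle_def fun_eq_iff le_iff_inf)
qed

section \<open>Membership rules for prime filters\<close>

lemma prime_filter_top: "prime_filter T \<Longrightarrow> \<^bold>1 \<in> T"
  and prime_filter_bot: "prime_filter T \<Longrightarrow> \<^bold>0 \<notin> T"
  and prime_filter_up: "prime_filter T \<Longrightarrow> a \<in> T \<Longrightarrow> a \<le> b \<Longrightarrow> b \<in> T"
  unfolding prime_filter_def by blast+

lemma prime_filter_meet: "prime_filter T \<Longrightarrow> a \<^bold>\<and> b \<in> T \<longleftrightarrow> a \<in> T \<and> b \<in> T"
  by (meson prime_filter_def inf_le1 inf_le2)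

lemma prime_filter_join: "prime_filter T \<Longrightarrow> a \<^bold>\<or> b \<in> T \<longleftrightarrow> a \<in> T \<or> b \<in> T"
  by (meson prime_filter_def sup_ge1 sup_ge2)

subsection \<open>Closed sets of prime filters and lattice congruences\<close>

text \<open>For a lattice congruence these are the preimages of the prime filters of the quotient
  lattice.\<close>

definition saturated_primes :: "'a::{distrib_lattice, bounded_lattice} rel \<Rightarrow> 'a set set"
  where "saturated_primes \<theta> = {T. prime_filter T \<and> saturated \<theta> T}"

lemma in_Theta_iff:
  "Y \<subseteq> prime_filters \<Longrightarrow> (a, b) \<in> Theta Y \<longleftrightarrow> (\<forall>T\<in>Y. a \<in> T \<longleftrightarrow> b \<in> T)"
  unfolding Theta_def sigma_A_def by blast

lemma topspace_priestley: "topspace priestley_topology = prime_filters"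
  unfolding priestley_topology_def topology_generated_by_topspace
  by (auto simp: sigma_A_def prime_filters_def dest: prime_filter_top)

lemma openin_sigma_diff: "openin priestley_topology (sigma_A a - sigma_A b)"
proof -
  have "openin priestley_topology (sigma_A a \<inter> (prime_filters - sigma_A b))"
    unfolding priestley_topology_def
    by (intro openin_Int topology_generated_by_Basis) auto
  moreover have "sigma_A a \<inter> (prime_filters - sigma_A b) = sigma_A a - sigma_A b"
    by (auto simp: sigma_A_def)
  ultimately show ?thesis
    by simp
qed

text \<open>Differences of \<open>sigma_A\<close> sets are closed under binary intersection: meet
  the first arguments and join the second ones. Hence they form a base, not merely a
  subbase.\<close>

lemma openin_priestley_base:
  assumes "openin priestley_topology U" "T \<in> U"
  obtains a b where "T \<in> sigma_A a - sigma_A b" "sigma_A a - sigma_A b \<subseteq> U"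
proof -
  have "generate_topology_on (range sigma_A \<union> range (\<lambda>a. prime_filters - sigma_A a)) U"
    using assms(1) unfolding priestley_topology_def by (rule openin_topology_generated_by)
  then have "T \<in> U \<Longrightarrow> \<exists>a b. T \<in> sigma_A a - sigma_A b \<and> sigma_A a - sigma_A b \<subseteq> U"
  proof (induction rule: generate_topology_on.induct)
    case Empty
    then show ?case by simp
  next
    case (Int U V)
    then obtain a b c d where *: "T \<in> sigma_A a - sigma_A b" "sigma_A a - sigma_A b \<subseteq> U"
      "T \<in> sigma_A c - sigma_A d" "sigma_A c - sigma_A d \<subseteq> V"
      by blast
    have "sigma_A (a \<^bold>\<and> c) - sigma_A (b \<^bold>\<or> d) = (sigma_A a - sigma_A b) \<inter> (sigma_A c - sigma_A d)"
      unfolding sigma_A_def prime_filters_def using prime_filter_meet prime_filter_join by blast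
    then have "T \<in> sigma_A (a \<^bold>\<and> c) - sigma_A (b \<^bold>\<or> d) \<and> sigma_A (a \<^bold>\<and> c) - sigma_A (b \<^bold>\<or> d) \<subseteq> U \<inter> V"
      using * by blast
    then show ?case
      by blast
  next
    case (UN K)
    then show ?case by blast
  next
    case (Basis s)
    \<comment> \<open>Each subbasic set is itself such a difference, with the bottom or the top as
      the other element.\<close>
    have "sigma_A a - sigma_A \<^bold>0 = sigma_A a" "sigma_A \<^bold>1 - sigma_A a = prime_filters - sigma_A a"
      for a :: 'a
      by (auto simp: sigma_A_def prime_filters_def prime_filter_top prime_filter_bot)
    then show ?case
      using Basis by blast
  qed
  then show ?thesis
    using assms(2) that by blast
qed

text \<open>A point \<open>T\<close> outside closed \<open>Y\<close> has a basic neighbourhood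
  \<open>sigma_A a - sigma_A b\<close> missing \<open>Y\<close>. Then \<open>a\<close> and its meet
  with \<open>b\<close> agree on \<open>Y\<close>, while \<open>T\<close> contains only the former,
  so \<open>T\<close> is not saturated.\<close>

lemma saturated_primes_Theta:
  assumes "closedin priestley_topology Y"
  shows "saturated_primes (Theta Y) = Y"
proof
  have Y: "Y \<subseteq> prime_filters"
    using closedin_subset[OF assms] by (simp add: topspace_priestley)
  show "Y \<subseteq> saturated_primes (Theta Y)"
    using Y in_Theta_iff[OF Y] unfolding saturated_primes_def saturated_def prime_filters_def by blast
  show "saturated_primes (Theta Y) \<subseteq> Y"
  proof
    fix T assume T: "T \<in> saturated_primes (Theta Y)"
    show "T \<in> Y"
    proof (rule ccontr)
      assume "T \<notin> Y"
      then have "T \<in> prime_filters - Y"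
        using T by (simp add: saturated_primes_def prime_filters_def)
      moreover have "openin priestley_topology (prime_filters - Y)"
        using assms by (simp add: closedin_def topspace_priestley)
      ultimately obtain a b
        where ab: "T \<in> sigma_A a - sigma_A b" "sigma_A a - sigma_A b \<subseteq> prime_filters - Y"
        using openin_priestley_base by metis
      have "(a, a \<^bold>\<and> b) \<in> Theta Y"
        unfolding in_Theta_iff[OF Y]
        using ab(2) Y prime_filter_meet unfolding sigma_A_def prime_filters_def by blast
      then have "a \<^bold>\<and> b \<in> T"
        using T ab(1) unfolding saturated_primes_def saturated_def sigma_A_def by blast
      then show False
        using T ab(1) prime_filter_meet
        unfolding saturated_primes_def sigma_A_def prime_filters_def by blast
    qed
  qed
qed

lemma saturated_primes_subset: "saturated_primes \<theta> \<subseteq> prime_filters"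
  by (auto simp: saturated_primes_def prime_filters_def)

text \<open>A prime filter fails to be saturated exactly when some pair \<open>(a, b)\<close> in
  \<open>\<theta>\<close> places it in the open set \<open>sigma_A a - sigma_A b\<close>.\<close>

lemma closedin_saturated_primes: "closedin priestley_topology (saturated_primes \<theta>)"
proof -
  have *: "prime_filters - saturated_primes \<theta> = (\<Union>(a, b)\<in>\<theta>. sigma_A a - sigma_A b)"
    unfolding saturated_primes_def saturated_def prime_filters_def sigma_A_def by blast
  have "openin priestley_topology (prime_filters - saturated_primes \<theta>)"
    unfolding * by (rule openin_Union) (auto simp: openin_sigma_diff)
  then show ?thesis
    using saturated_primes_subset by (simp add: closedin_def topspace_priestley)
qed

text \<open>If \<open>a\<close> is not below \<open>b\<close> in the quotient, separating
  \<open>{a}\<close> from \<open>{b}\<close> gives a saturated prime filter that tells them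
  apart.\<close>

lemma (in lattice_congruence) Theta_saturated_primes: "Theta (saturated_primes \<theta>) = \<theta>"
proof -
  have sep: "\<exists>T\<in>saturated_primes \<theta>. a \<in> T \<and> b \<notin> T" if nle: "\<not> a \<preceq> b" for a b
  proof -
    obtain T where "prime_filter T" "saturated \<theta> T" "{a} \<subseteq> T" "T \<inter> {b} = {}"
      by (rule prime_filter_separation[of "{a}" "{b}"]) (use nle in auto)
    then show ?thesis
      unfolding saturated_primes_def by blast
  qed
  have "(a, b) \<in> Theta (saturated_primes \<theta>) \<longleftrightarrow> (a, b) \<in> \<theta>" for a b
  proof
    assume "(a, b) \<in> Theta (saturated_primes \<theta>)"
    then have "\<forall>T\<in>saturated_primes \<theta>. a \<in> T \<longleftrightarrow> b \<in> T"
      by (simp add: in_Theta_iff[OF saturated_primes_subset])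
    then have "a \<preceq> b" "b \<preceq> a"
      using sep by blast+
    then show "(a, b) \<in> \<theta>"
      by (rule qle_antisym)
  next
    assume "(a, b) \<in> \<theta>"
    then show "(a, b) \<in> Theta (saturated_primes \<theta>)"
      using cong_sym unfolding in_Theta_iff[OF saturated_primes_subset]
      unfolding saturated_primes_def saturated_def by blast
  qed
  then show ?thesis
    by auto
qed

lemma lattice_congruence_Theta:
  assumes Y: "Y \<subseteq> prime_filters"
  shows "lattice_congruence (Theta Y)"
proof
  show "equiv UNIV (Theta Y)"
    unfolding Theta_def equiv_def refl_on_def sym_def trans_def by auto
  fix a b c d assume "(a, b) \<in> Theta Y" "(c, d) \<in> Theta Y"
  then show "(a \<^bold>\<and> c, b \<^bold>\<and> d) \<in> Theta Y" "(a \<^bold>\<or> c, b \<^bold>\<or> d) \<in> Theta Y"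
    using Y unfolding in_Theta_iff[OF Y] prime_filters_def
    by (metis (no_types, lifting) mem_Collect_eq prime_filter_meet subsetD,
        metis (no_types, lifting) mem_Collect_eq prime_filter_join subsetD)
qed

subsection \<open>The tense operators\<close>

text \<open>Condition (tc1); condition (tc2) is \<open>tense_closed H P\<close>.\<close>

definition tense_closed ::
  "('a::{distrib_lattice, bounded_lattice} \<Rightarrow> 'a) \<Rightarrow> ('a \<Rightarrow> 'a) \<Rightarrow> 'a set set \<Rightarrow> bool"
  where "tense_closed G F Y \<longleftrightarrow>
    (\<forall>x\<in>Y. \<forall>y. (x, y) \<in> R_A G F \<longrightarrow>
      (\<exists>w\<^sub>1 \<in> R_A G F `` {x} \<inter> Y. \<exists>w\<^sub>2 \<in> R_A G F `` {x} \<inter> Y. w\<^sub>1 \<subseteq> y \<and> y \<subseteq> w\<^sub>2))"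

section \<open>Future and past operators of one algebra\<close>

context tDL_algebra
begin

text \<open>The axioms come in mirror pairs, so every fact about \<open>G\<close> and
  \<open>F\<close> transfers to \<open>H\<close> and \<open>P\<close>.\<close>

lemma dual_tDL_algebra: "tDL_algebra H G P F"
  by unfold_locales
    (fact G_one H_one G_meet H_meet le_GP le_HF G_join H_join F_zero P_zero F_join P_join
      PG_le FH_le F_meet P_meet)+

lemma G_mono: "x \<le> y \<Longrightarrow> G x \<le> G y"
  by (metis G_meet le_iff_inf)

lemma F_mono: "x \<le> y \<Longrightarrow> F x \<le> F y"
  by (metis F_join le_iff_sup)

text \<open>The laws linking future and past do the work: \<open>F (H a) \<le> a\<close> brings
  \<open>a\<close> back into \<open>S\<close> when \<open>H a\<close> is in \<open>T\<close>, and
  \<open>a \<le> G (P a)\<close> sends \<open>P a\<close> into \<open>T\<close> when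
  \<open>a\<close> is in \<open>S\<close>.\<close>

lemma R_subset_R_dual: "(S, T) \<in> R_A G F \<Longrightarrow> (T, S) \<in> R_A H P"
proof -
  assume "(S, T) \<in> R_A G F"
  then have S: "prime_filter S" and T: "prime_filter T"
    and GT: "\<And>a. G a \<in> S \<Longrightarrow> a \<in> T" and TF: "\<And>a. a \<in> T \<Longrightarrow> F a \<in> S"
    by (auto simp: R_A_def prime_filters_def)
  have "a \<in> S" if "H a \<in> T" for a
    using prime_filter_up[OF S TF[OF that] FH_le] .
  moreover have "P a \<in> T" if "a \<in> S" for a
    using GT prime_filter_up[OF S that le_GP] .
  ultimately show ?thesis
    using S T by (auto simp: R_A_def prime_filters_def)
qed

lemma R_converse: "(R_A G F)\<inverse> = R_A H P"
  using R_subset_R_dual tDL_algebra.R_subset_R_dual[OF dual_tDL_algebra] by auto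

text \<open>Since \<open>R_A H P\<close> is the converse of \<open>R_A G F\<close>, (tc2) is (tc1)
  for the past operators; the quantifiers over prime filters are absorbed because the relation holds
  only between those.\<close>

lemma tPS_set_iff:
  "tPS_set G F Y \<longleftrightarrow> Y \<subseteq> prime_filters \<and> tense_closed G F Y \<and> tense_closed H P Y"
proof -
  have "x \<in> R_A H P `` {y} \<longleftrightarrow> (x, y) \<in> R_A G F" "x \<in> R_A G F `` {y} \<longleftrightarrow> (x, y) \<in> R_A H P" for x y
    unfolding R_converse[symmetric] by auto
  moreover have "(S, T) \<in> R_A K L \<Longrightarrow> S \<in> prime_filters \<and> T \<in> prime_filters" for S T K L
    by (auto simp: R_A_def)
  ultimately show ?thesis
    unfolding tPS_set_def tense_closed_def R_converse Int_iff by meson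
qed

text \<open>The successor must contain \<open>?D\<close> and avoid both \<open>b\<close> and every
  \<open>c\<close> with \<open>F c\<close> outside \<open>x\<close>, hence their joins in
  \<open>?I\<close>. A collision of \<open>?D\<close> with \<open>?I\<close> is excluded by the
  axiom bounding \<open>G\<close> of a join by \<open>G\<close> and \<open>F\<close>, together with
  primality of \<open>x\<close>.\<close>

lemma ex_R_notin:
  assumes x: "prime_filter x" and b: "G b \<notin> x"
  obtains y where "(x, y) \<in> R_A G F" "b \<notin> y"
proof -
  let ?D = "{a. G a \<in> x}" and ?I = "{b \<^bold>\<or> c | c. F c \<notin> x}"
  have G1: "G \<^bold>1 \<in> x" and F0: "F \<^bold>0 \<notin> x"
    using x by (simp_all add: G_one F_zero prime_filter_top prime_filter_bot)
  \<comment> \<open>Choosing the bottom for \<open>c\<close> puts \<open>b\<close> itself into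
    \<open>?I\<close>; this shows \<open>?I\<close> nonempty and later keeps \<open>b\<close> out of
    \<open>y\<close>.\<close>
  then have b0: "b \<^bold>\<or> \<^bold>0 \<in> ?I"
    by blast
  obtain y where y: "prime_filter y" "?D \<subseteq> y" "y \<inter> ?I = {}"
  proof (rule Id_cong.prime_filter_separation[of ?D ?I])
    show "?D \<noteq> {}" "?I \<noteq> {}"
      using G1 b0 by blast+
    show "d \<^bold>\<and> e \<in> ?D" if "d \<in> ?D" "e \<in> ?D" for d e
      using that by (simp add: G_meet prime_filter_meet[OF x])
    show "i \<^bold>\<or> j \<in> ?I" if ij: "i \<in> ?I" "j \<in> ?I" for i j
    proof -
      obtain c d where "F c \<notin> x" "F d \<notin> x" "i = b \<^bold>\<or> c" "j = b \<^bold>\<or> d"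
        using ij by blast
      then have "F (c \<^bold>\<or> d) \<notin> x" "i \<^bold>\<or> j = b \<^bold>\<or> (c \<^bold>\<or> d)"
        by (simp_all add: F_join prime_filter_join[OF x] sup_assoc sup_left_commute)
      then show ?thesis
        by blast
    qed
    show "\<not> d \<le> i" if di: "d \<in> ?D" "i \<in> ?I" for d i
    proof
      assume "d \<le> i"
      moreover obtain c where c: "F c \<notin> x" "i = b \<^bold>\<or> c"
        using di by blast
      ultimately have "G d \<le> G b \<^bold>\<or> F c"
        using G_mono G_join order_trans by blast
      then show False
        using di c b prime_filter_up[OF x] prime_filter_join[OF x] by blast
    qed
  qed
  have "F c \<in> x" if "c \<in> y" for c
    using that y prime_filter_join[OF y(1)] by blast
  then have "(x, y) \<in> R_A G F"
    using x y by (auto simp: R_A_def prime_filters_def)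
  moreover have "b \<notin> y"
    using b0 y(3) by auto
  ultimately show ?thesis
    using that by blast
qed

text \<open>Order-dual to the construction for \<open>G\<close>: now \<open>a\<close> is added to
  the filter side, and a collision is excluded by the axiom \<open>F_mono\<close> combines with,
  \<open>F_meet\<close>.\<close>

lemma ex_R_in:
  assumes x: "prime_filter x" and a: "F a \<in> x"
  obtains y where "(x, y) \<in> R_A G F" "a \<in> y"
proof -
  let ?D = "{d \<^bold>\<and> a | d. G d \<in> x}" and ?I = "{c. F c \<notin> x}"
  have G1: "G \<^bold>1 \<in> x" and F0: "F \<^bold>0 \<notin> x"
    using x by (simp_all add: G_one F_zero prime_filter_top prime_filter_bot)
  then have a1: "\<^bold>1 \<^bold>\<and> a \<in> ?D"
    by blast
  obtain y where y: "prime_filter y" "?D \<subseteq> y" "y \<inter> ?I = {}"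
  proof (rule Id_cong.prime_filter_separation[of ?D ?I])
    show "?D \<noteq> {}" "?I \<noteq> {}"
      using F0 a1 by blast+
    show "i \<^bold>\<or> j \<in> ?I" if "i \<in> ?I" "j \<in> ?I" for i j
      using that by (simp add: F_join prime_filter_join[OF x])
    show "i \<^bold>\<and> j \<in> ?D" if ij: "i \<in> ?D" "j \<in> ?D" for i j
    proof -
      obtain c d where "G c \<in> x" "G d \<in> x" "i = c \<^bold>\<and> a" "j = d \<^bold>\<and> a"
        using ij by blast
      then have "G (c \<^bold>\<and> d) \<in> x" "i \<^bold>\<and> j = (c \<^bold>\<and> d) \<^bold>\<and> a"
        by (simp_all add: G_meet prime_filter_meet[OF x] inf_assoc inf_left_commute)
      then show ?thesis
        by blast
    qed
    show "\<not> d \<le> i" if di: "d \<in> ?D" "i \<in> ?I" for d i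
    proof
      assume "d \<le> i"
      moreover obtain c where c: "G c \<in> x" "d = c \<^bold>\<and> a"
        using di by blast
      ultimately have "G c \<^bold>\<and> F a \<le> F i"
        using F_mono F_meet order_trans by blast
      then show False
        using di c a prime_filter_up[OF x] prime_filter_meet[OF x] by blast
    qed
  qed
  have "c \<in> y" if "G c \<in> x" for c
    using that y prime_filter_meet[OF y(1)] by blast
  then have "(x, y) \<in> R_A G F"
    using x y by (auto simp: R_A_def prime_filters_def)
  moreover have "a \<in> y"
    using a1 y(2) by auto
  ultimately show ?thesis
    using that by blast
qed

text \<open>The two witnesses of \<open>tense_closed\<close> serve different operators: the one
  below \<open>y\<close> still omits \<open>b\<close>, as \<open>G\<close> requires, and the one
  above \<open>y\<close> still contains \<open>a\<close>, as \<open>F\<close> requires.\<close>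

lemma Theta_compatible:
  assumes Y: "Y \<subseteq> prime_filters" "tense_closed G F Y" and ab: "(a, b) \<in> Theta Y"
  shows "(G a, G b) \<in> Theta Y" "(F a, F b) \<in> Theta Y"
proof -
  \<comment> \<open>The pair is quantified afresh so that the implication also applies with
    \<open>a\<close> and \<open>b\<close> exchanged.\<close>
  have "G b \<in> x" if x: "x \<in> Y" and "(a, b) \<in> Theta Y" "G a \<in> x" for x a b
  proof (rule ccontr)
    assume "G b \<notin> x"
    then obtain y where "(x, y) \<in> R_A G F" "b \<notin> y"
      using ex_R_notin x Y(1) unfolding prime_filters_def by blast
    then obtain w where "w \<in> Y" "(x, w) \<in> R_A G F" "b \<notin> w"
      using Y(2) x unfolding tense_closed_def by blast
    moreover then have "a \<in> w"
      using that by (auto simp: R_A_def)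
    ultimately show False
      using that in_Theta_iff[OF Y(1)] by blast
  qed
  then show "(G a, G b) \<in> Theta Y"
    using ab unfolding in_Theta_iff[OF Y(1)] by blast
  have "F b \<in> x" if x: "x \<in> Y" and "(a, b) \<in> Theta Y" "F a \<in> x" for x a b
  proof -
    obtain y where "(x, y) \<in> R_A G F" "a \<in> y"
      using ex_R_in x \<open>F a \<in> x\<close> Y(1) unfolding prime_filters_def by blast
    then obtain w where "w \<in> Y" "(x, w) \<in> R_A G F" "a \<in> w"
      using Y(2) x unfolding tense_closed_def by blast
    moreover then have "b \<in> w"
      using that in_Theta_iff[OF Y(1)] by blast
    ultimately show ?thesis
      by (auto simp: R_A_def)
  qed
  then show "(F a, F b) \<in> Theta Y"
    using ab unfolding in_Theta_iff[OF Y(1)] by blast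
qed

text \<open>Both witnesses come from separation modulo \<open>\<theta>\<close>: the lower one lies
  between \<open>{a. G a \<in> x}\<close> and \<open>y\<close>, the upper one between
  \<open>y\<close> and \<open>{a. F a \<in> x}\<close>.\<close>

lemma tense_closed_saturated_primes:
  assumes "lattice_congruence \<theta>"
    and compat: "\<And>a b. (a, b) \<in> \<theta> \<Longrightarrow> (G a, G b) \<in> \<theta> \<and> (F a, F b) \<in> \<theta>"
  shows "tense_closed G F (saturated_primes \<theta>)"
proof -
  interpret lattice_congruence \<theta>
    by fact
  have "\<exists>w\<^sub>1 \<in> R_A G F `` {x} \<inter> saturated_primes \<theta>. \<exists>w\<^sub>2 \<in> R_A G F `` {x} \<inter> saturated_primes \<theta>.
      w\<^sub>1 \<subseteq> y \<and> y \<subseteq> w\<^sub>2"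
    if x: "x \<in> saturated_primes \<theta>" and xy: "(x, y) \<in> R_A G F" for x y
  proof -
    have px: "prime_filter x" and sat: "\<And>a b. (a, b) \<in> \<theta> \<Longrightarrow> a \<in> x \<Longrightarrow> b \<in> x"
      using x by (auto simp: saturated_primes_def saturated_def)
    have py: "prime_filter y" and Gy: "\<And>a. G a \<in> x \<Longrightarrow> a \<in> y" and yF: "\<And>a. a \<in> y \<Longrightarrow> F a \<in> x"
      using xy by (auto simp: R_A_def prime_filters_def)
    have G1: "G \<^bold>1 \<in> x" and F0: "F \<^bold>0 \<notin> x"
      using px by (simp_all add: G_one F_zero prime_filter_top prime_filter_bot)
    obtain w\<^sub>1 where w1: "prime_filter w\<^sub>1" "saturated \<theta> w\<^sub>1" "{a. G a \<in> x} \<subseteq> w\<^sub>1" "w\<^sub>1 \<inter> - y = {}"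
    proof (rule prime_filter_separation[of "{a. G a \<in> x}" "- y"])
      show "{a. G a \<in> x} \<noteq> {}" "- y \<noteq> {}"
        using G1 prime_filter_bot[OF py] by blast+
      show "a \<^bold>\<and> b \<in> {a. G a \<in> x}" if "a \<in> {a. G a \<in> x}" "b \<in> {a. G a \<in> x}" for a b
        using that by (simp add: G_meet prime_filter_meet[OF px])
      show "a \<^bold>\<or> b \<in> - y" if "a \<in> - y" "b \<in> - y" for a b
        using that by (simp add: prime_filter_join[OF py])
      show "\<not> d \<preceq> i" if "d \<in> {a. G a \<in> x}" "i \<in> - y" for d i
      proof
        assume "d \<preceq> i"
        \<comment> \<open>\<open>d\<close> is congruent to its meet with \<open>i\<close>, hence so
          are their images under \<open>G\<close>, and \<open>x\<close> is saturated. This would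
          force \<open>i\<close> into \<open>y\<close>.\<close>
        then have "G (d \<^bold>\<and> i) \<in> x"
          using that sat compat cong_sym unfolding qle_def by blast
        then show False
          using that Gy by (auto simp: G_meet prime_filter_meet[OF px])
      qed
    qed
    obtain w\<^sub>2 where w2: "prime_filter w\<^sub>2" "saturated \<theta> w\<^sub>2" "y \<subseteq> w\<^sub>2" "w\<^sub>2 \<inter> {a. F a \<notin> x} = {}"
    proof (rule prime_filter_separation[of y "{a. F a \<notin> x}"])
      show "y \<noteq> {}" "{a. F a \<notin> x} \<noteq> {}"
        using F0 prime_filter_top[OF py] by blast+
      show "a \<^bold>\<and> b \<in> y" if "a \<in> y" "b \<in> y" for a b
        using that by (simp add: prime_filter_meet[OF py])
      show "a \<^bold>\<or> b \<in> {a. F a \<notin> x}" if "a \<in> {a. F a \<notin> x}" "b \<in> {a. F a \<notin> x}" for a b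
        using that by (simp add: F_join prime_filter_join[OF px])
      show "\<not> d \<preceq> i" if "d \<in> y" "i \<in> {a. F a \<notin> x}" for d i
      proof
        assume "d \<preceq> i"
        then have "F (d \<^bold>\<and> i) \<in> x"
          using that yF sat compat cong_sym unfolding qle_def by blast
        then show False
          using that F_mono[OF inf_le2] prime_filter_up[OF px] by blast
      qed
    qed
    \<comment> \<open>Separation supplies one inclusion of the relation for each witness; the other
      is inherited from \<open>y\<close> by \<open>w\<^sub>1 \<subseteq> y\<close> and
      \<open>y \<subseteq> w\<^sub>2\<close>.\<close>
    have "(x, w\<^sub>1) \<in> R_A G F" "(x, w\<^sub>2) \<in> R_A G F"
      using px w1 w2 Gy yF by (auto simp: R_A_def prime_filters_def)
    then show ?thesis
      using w1 w2 unfolding saturated_primes_def by blast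
  qed
  then show ?thesis
    unfolding tense_closed_def by blast
qed

section \<open>The bijection between closed tPS-sets and congruences\<close>

lemma tDL_congruence_iff:
  "tDL_congruence G H F P \<theta> \<longleftrightarrow> lattice_congruence \<theta> \<and>
    (\<forall>a b. (a, b) \<in> \<theta> \<longrightarrow> (G a, G b) \<in> \<theta> \<and> (H a, H b) \<in> \<theta> \<and> (F a, F b) \<in> \<theta> \<and> (P a, P b) \<in> \<theta>)"
  unfolding tDL_congruence_def lattice_congruence_def by auto

lemma tDL_congruence_Theta:
  assumes "tPS_set G F Y"
  shows "tDL_congruence G H F P (Theta Y)"
  using assms lattice_congruence_Theta[of Y] Theta_compatible[of Y]
    tDL_algebra.Theta_compatible[OF dual_tDL_algebra, of Y]
  unfolding tPS_set_iff tDL_congruence_iff by simp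

lemma tPS_set_saturated_primes:
  assumes "tDL_congruence G H F P \<theta>"
  shows "tPS_set G F (saturated_primes \<theta>)"
  using assms saturated_primes_subset tense_closed_saturated_primes
    tDL_algebra.tense_closed_saturated_primes[OF dual_tDL_algebra]
  unfolding tPS_set_iff tDL_congruence_iff by simp

lemma bij_betw_Theta:
  "bij_betw Theta {Y. tPS_set G F Y \<and> closedin priestley_topology Y} {\<theta>. tDL_congruence G H F P \<theta>}"
proof (rule bij_betw_byWitness[where f' = saturated_primes])
  show "\<forall>\<theta>\<in>{\<theta>. tDL_congruence G H F P \<theta>}. Theta (saturated_primes \<theta>) = \<theta>"
    using lattice_congruence.Theta_saturated_primes by (auto simp: tDL_congruence_iff)
qed (auto simp: saturated_primes_Theta tDL_congruence_Theta tPS_set_saturated_primes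
  closedin_saturated_primes)

end

text \<open>A smaller congruence has more saturated prime filters, and for closed sets these recover
  the set itself.\<close>

lemma Theta_antimono_iff:
  assumes "closedin priestley_topology Y" "closedin priestley_topology Z"
  shows "Theta Y \<subseteq> Theta Z \<longleftrightarrow> Z \<subseteq> Y"
proof
  assume "Theta Y \<subseteq> Theta Z"
  then have "saturated_primes (Theta Z) \<subseteq> saturated_primes (Theta Y)"
    by (auto simp: saturated_primes_def saturated_def)
  then show "Z \<subseteq> Y"
    using assms by (simp add: saturated_primes_Theta)
next
  assume "Z \<subseteq> Y"
  then show "Theta Y \<subseteq> Theta Z"
    unfolding Theta_def by blast
qed

subsection \<open>The lattices\<close>

lemma partial_order_inclusion_order: "partial_order (inclusion_order \<C>)"
  by unfold_locales auto

text \<open>The congruences contain the total relation and are closed under arbitrary intersections,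
  so they even form a complete lattice.\<close>

lemma lattice_congruence_lattice: "lattice (congruence_lattice G H F P)"
proof -
  let ?L = "congruence_lattice G H F P"
  interpret partial_order ?L
    unfolding congruence_lattice_def by (rule partial_order_inclusion_order)
  have UNIV_cong: "tDL_congruence G H F P UNIV"
    by (auto simp: tDL_congruence_def equiv_def refl_on_def sym_def trans_def)
  have Inter_cong: "tDL_congruence G H F P (\<Inter>A)"
    if cong: "\<And>\<theta>. \<theta> \<in> A \<Longrightarrow> tDL_congruence G H F P \<theta>" for A
  proof -
    have e: "refl \<theta>" "sym \<theta>" "trans \<theta>" if "\<theta> \<in> A" for \<theta>
      using cong[OF that] by (auto simp: tDL_congruence_def equiv_def)
    have "equiv UNIV (\<Inter>A)"
      by (intro equivI refl_onI symI transI InterI; (meson InterD UNIV_I e refl_onD symD transD)?) auto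
    then show ?thesis
      using cong unfolding tDL_congruence_def by simp
  qed
  interpret complete_lattice ?L
  proof (rule complete_lattice_criterion1)
    show "\<exists>g. greatest ?L g (carrier ?L)"
      using UNIV_cong by (auto simp: greatest_def congruence_lattice_def)
    fix A assume "A \<subseteq> carrier ?L" "A \<noteq> {}"
    then have "greatest ?L (\<Inter>A) (Lower ?L A)"
      using Inter_cong[of A] by (auto simp: greatest_def Lower_def congruence_lattice_def)
    then show "\<exists>i. greatest ?L i (Lower ?L A)" ..
  qed
  show ?thesis
    by (rule lattice_axioms)
qed

text \<open>An order isomorphism matches upper bounds of \<open>A\<close> with those of its image.
  The statement is about \<open>least\<close>, so it can be applied before joins are known to exist
  in \<open>L\<close>.\<close>

lemma least_order_iso:
  assumes h: "bij_betw h (carrier L) (carrier M)"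
    and le: "\<And>x y. x \<in> carrier L \<Longrightarrow> y \<in> carrier L \<Longrightarrow> h x \<sqsubseteq>\<^bsub>M\<^esub> h y \<longleftrightarrow> x \<sqsubseteq>\<^bsub>L\<^esub> y"
    and "x \<in> carrier L" "A \<subseteq> carrier L"
  shows "least M (h x) (Upper M (h ` A)) \<longleftrightarrow> least L x (Upper L A)"
proof -
  have carr: "h u \<in> carrier M" if "u \<in> carrier L" for u
    using h that by (auto simp: bij_betw_def)
  have mem: "h u \<in> Upper M (h ` A) \<longleftrightarrow> u \<in> Upper L A" if "u \<in> carrier L" for u
    using that \<open>A \<subseteq> carrier L\<close> carr le by (auto simp: Upper_def subset_iff)
  have "(\<forall>z\<in>Upper M (h ` A). h x \<sqsubseteq>\<^bsub>M\<^esub> z) \<longleftrightarrow> (\<forall>u\<in>Upper L A. x \<sqsubseteq>\<^bsub>L\<^esub> u)"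
  proof (intro iffI ballI)
    fix u assume *: "\<forall>z\<in>Upper M (h ` A). h x \<sqsubseteq>\<^bsub>M\<^esub> z" "u \<in> Upper L A"
    then have "u \<in> carrier L"
      using Upper_closed[of L A] by blast
    then show "x \<sqsubseteq>\<^bsub>L\<^esub> u"
      using * mem[of u] le[of x u] \<open>x \<in> carrier L\<close> by simp
  next
    fix z assume *: "\<forall>u\<in>Upper L A. x \<sqsubseteq>\<^bsub>L\<^esub> u" "z \<in> Upper M (h ` A)"
    then have "z \<in> h ` carrier L"
      using h by (auto simp: bij_betw_def Upper_def)
    then obtain u where "u \<in> carrier L" "z = h u"
      by blast
    then show "h x \<sqsubseteq>\<^bsub>M\<^esub> z"
      using * mem[of u] le[of x u] \<open>x \<in> carrier L\<close> by simp
  qed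
  then show ?thesis
    using mem \<open>x \<in> carrier L\<close> by (simp add: least_def)
qed

text \<open>Joins of \<open>L\<close> are obtained by pulling back those of \<open>M\<close>, so
  closed tPS-sets need no explicit description of their joins.\<close>

lemma order_iso_upper_semilattice:
  assumes "upper_semilattice M" "partial_order L"
    and h: "bij_betw h (carrier L) (carrier M)"
    and le: "\<And>x y. x \<in> carrier L \<Longrightarrow> y \<in> carrier L \<Longrightarrow> h x \<sqsubseteq>\<^bsub>M\<^esub> h y \<longleftrightarrow> x \<sqsubseteq>\<^bsub>L\<^esub> y"
  shows "upper_semilattice L"
    and "x \<in> carrier L \<Longrightarrow> y \<in> carrier L \<Longrightarrow> h (x \<squnion>\<^bsub>L\<^esub> y) = h x \<squnion>\<^bsub>M\<^esub> h y"
proof -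
  interpret M: upper_semilattice M by fact
  interpret L: partial_order L by fact
  have *: "\<exists>s\<in>carrier L. least L s (Upper L {x, y}) \<and> least M (h s) (Upper M {h x, h y})"
    if "x \<in> carrier L" "y \<in> carrier L" for x y
  proof -
    have "h x \<in> carrier M" "h y \<in> carrier M"
      using h that by (auto simp: bij_betw_def)
    then obtain t where t: "least M t (Upper M {h x, h y})"
      using M.sup_of_two_exists by blast
    then have "t \<in> carrier M"
      unfolding least_def by blast
    then obtain s where "s \<in> carrier L" "t = h s"
      using h by (auto simp: bij_betw_def)
    then show ?thesis
      using t least_order_iso[OF h le, of s "{x, y}"] that by auto
  qed
  show L: "upper_semilattice L"
    by unfold_locales (use * in blast)
  then interpret L: upper_semilattice L .
  show "h (x \<squnion>\<^bsub>L\<^esub> y) = h x \<squnion>\<^bsub>M\<^esub> h y" if xy: "x \<in> carrier L" "y \<in> carrier L"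
  proof -
    obtain s where s: "least L s (Upper L {x, y})" "least M (h s) (Upper M {h x, h y})"
      using *[OF xy] by blast
    have "x \<squnion>\<^bsub>L\<^esub> y = s"
      unfolding join_def sup_def using s(1) L.least_unique by blast
    moreover have "h x \<squnion>\<^bsub>M\<^esub> h y = h s"
      unfolding join_def sup_def using s(2) M.least_unique by blast
    ultimately show ?thesis
      by simp
  qed
qed

lemma order_iso_lattice_isomorphism:
  assumes M: "lattice M" and L: "partial_order L"
    and h: "bij_betw h (carrier L) (carrier M)"
    and le: "\<And>x y. x \<in> carrier L \<Longrightarrow> y \<in> carrier L \<Longrightarrow> h x \<sqsubseteq>\<^bsub>M\<^esub> h y \<longleftrightarrow> x \<sqsubseteq>\<^bsub>L\<^esub> y"
  shows "lattice L \<and> lattice_isomorphism L M h"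
proof -
  interpret M: lattice M by fact
  interpret M': lattice "inv_gorder M" by (rule M.dual_lattice)
  have L': "partial_order (inv_gorder L)"
    using L by (rule partial_order.dual_order)
  note up = order_iso_upper_semilattice[OF M.upper_semilattice_axioms L h le]
  \<comment> \<open>Meets are joins for the inverted orders, and \<open>h\<close> remains an order
    isomorphism when both orders are inverted.\<close>
  have up': "upper_semilattice (inv_gorder L)"
    "x \<in> carrier L \<Longrightarrow> y \<in> carrier L \<Longrightarrow> h (x \<sqinter>\<^bsub>L\<^esub> y) = h x \<sqinter>\<^bsub>M\<^esub> h y" for x y
    using order_iso_upper_semilattice[OF M'.upper_semilattice_axioms L', of h] h le by auto
  have "lattice L"
    using L up(1) upper_semilattice.sup_of_two_exists[OF up'(1)]
    by (simp add: lattice_def lower_semilattice_def lower_semilattice_axioms_def)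
  then show ?thesis
    using h up(2) up'(2) by (simp add: lattice_isomorphism_def)
qed

theorem theorem4p6:
  fixes G H F P :: "'a::{distrib_lattice, bounded_lattice} \<Rightarrow> 'a"
  assumes "tDL_algebra G H F P"
  shows "lattice (closed_tPS_lattice G F) \<and>
    lattice (congruence_lattice G H F P) \<and>
    lattice_isomorphism (closed_tPS_lattice G F) (inv_gorder (congruence_lattice G H F P)) Theta"
proof -
  interpret tDL_algebra G H F P by fact
  interpret Con: lattice "congruence_lattice G H F P"
    by (rule lattice_congruence_lattice)
  have "lattice (closed_tPS_lattice G F) \<and>
    lattice_isomorphism (closed_tPS_lattice G F) (inv_gorder (congruence_lattice G H F P)) Theta"
  \<comment> \<open>Inverting the order of congruences turns the order-reversing
    \<open>Theta\<close> into an order isomorphism, which also makes the closed tPS-sets a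
    lattice.\<close>
  proof (rule order_iso_lattice_isomorphism)
    show "lattice (inv_gorder (congruence_lattice G H F P))"
      by (rule Con.dual_lattice)
    show "partial_order (closed_tPS_lattice G F)"
      unfolding closed_tPS_lattice_def by (rule partial_order_inclusion_order)
  qed (use bij_betw_Theta Theta_antimono_iff in
    \<open>auto simp: closed_tPS_lattice_def congruence_lattice_def\<close>)
  then show ?thesis
    using Con.lattice_axioms by blast
qed

end
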